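(* Let $R$ be a supertropical domain, let $n\ge1$, and let $A\in M_n(R)$ be a matrix whose tropical determinant $|A|$ is invertible in $R$. Put $A^\nabla=\dfrac{\mathbb 1}{|A|}\operatorname{adj}(A)$. Then $AA^\nabla$ and $A^\nabla A$ are quasi-identity matrices (not necessarily the same), and thus $A^\nabla$ is a quasi-inverse for $A$.
   Context: A supertropical semiring $(R,\mathcal G_0,\nu)$ is a commutative semiring $R$ with unit $\mathbb 1$ and zero $\mathbb 0$ (with $\mathbb 0 r=\mathbb 0$ for all $r$), a semiring ideal $\mathcal G_0=\mathcal G\cup\{\mathbb 0\}$ (the ghost ideal, where $\mathcal G=\mathcal G_0\setminus\{\mathbb 0\}$), and an idempotent map $\nu:R\to\mathcal G_0$, written $a^\nu=\nu(a)$, preserving addition and multiplication, given by $\nu(a)=a+a$ and equal to the identity on $\mathcal G_0$, such that $a+b=a^\nu$ if $a^\nu=b^\nu$, and $a+b\in\{a,b\}$ if $a^\nu\ne b^\nu$. $\mathcal G_0$ is totally ordered by $a^\nu\le b^\nu$ iff $a^\nu+b^\nu=b^\nu$. Tangible elements: $\mathcal T=R\setminus\mathcal G_0$. It is a supertropical domain if $\mathcal T$ is a multiplicative monoid (closed under multiplication, containing $\mathbb 1$) and $\nu|_{\mathcal T}:\mathcal T\to\mathcal G$ is onto. Tropical determinant: $|A|=\sum_{\pi\in S_n}a_{1,\pi(1)}\cdots a_{n,\pi(n)}$ (the empty determinant is $\mathbb 1$). $A$ is nonsingular if $|A|\in\mathcal T$. $\operatorname{adj}(A)$ is the transpose of $(a'_{i,j})$,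 where $a'_{i,j}$ is the tropical determinant of the matrix obtained from $A$ by deleting row $i$ and column $j$ (no signs). A quasi-zero matrix is a matrix with $\mathbb 0$ on the diagonal and all off-diagonal entries in $\mathcal G_0$. A quasi-identity is a nonsingular, multiplicatively idempotent matrix of the form $I+Z$ with $I$ the identity matrix and $Z$ a quasi-zero matrix. A matrix $B$ is a quasi-inverse for $A$ if $AB$ and $BA$ are both quasi-identities. *)

theory Defs
  imports "Jordan_Normal_Form.Determinant"
begin

(* The semiring R is the whole type 'a.  The class comm_semiring_1 includes 0 \<noteq> 1; for a
   supertropical domain this is no restriction, since 1 is tangible while 0 lies in the ghost
   ideal. *)

locale supertropical_semiring =
  fixes G0 :: "'a::comm_semiring_1 set" and \<nu> :: "'a \<Rightarrow> 'a"
  assumes zero_ghost: "0 \<in> G0"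
    and add_ghost: "a \<in> G0 \<Longrightarrow> b \<in> G0 \<Longrightarrow> a + b \<in> G0"
    and mult_ghost: "a \<in> G0 \<Longrightarrow> r * a \<in> G0"
    and nu_ghost: "\<nu> a \<in> G0"
    and nu_idem: "\<nu> (\<nu> a) = \<nu> a"
    and nu_add: "\<nu> (a + b) = \<nu> a + \<nu> b"
    and nu_mult: "\<nu> (a * b) = \<nu> a * \<nu> b"
    and nu_eq: "\<nu> a = a + a"
    and nu_id: "a \<in> G0 \<Longrightarrow> \<nu> a = a"
    and add_nu_eq: "\<nu> a = \<nu> b \<Longrightarrow> a + b = \<nu> a"
    and add_nu_neq: "\<nu> a \<noteq> \<nu> b \<Longrightarrow> a + b \<in> {a, b}"

(* The total order on the ghost ideal is a consequence of the axioms, hence not assumed above. *)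
lemma (in supertropical_semiring) ghost_linear_order:
  "linear_order_on G0 {(a, b). a \<in> G0 \<and> b \<in> G0 \<and> \<nu> a + \<nu> b = \<nu> b}"
proof -
  have "a + a = a" if "a \<in> G0" for a
    using nu_eq[of a] nu_id[OF that] by simp
  moreover have "a + b = a \<or> a + b = b" if "a \<in> G0" "b \<in> G0" for a b
    using add_nu_eq[of a b] add_nu_neq[of a b] nu_id that by fastforce
  moreover have "a + c = c" if "a + b = b" "b + c = c" for a b c :: 'a
    using that by (metis add.assoc)
  ultimately show ?thesis
    unfolding linear_order_on_def partial_order_on_def preorder_on_def refl_on_def trans_def
      antisym_def total_on_def
    by (auto simp: nu_id) (metis add.commute)+
qed

definition tangible :: "'a set \<Rightarrow> 'a set" where
  "tangible G0 = UNIV - G0"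

locale supertropical_domain = supertropical_semiring +
  assumes one_tangible: "1 \<in> tangible G0"
    and mult_tangible: "a \<in> tangible G0 \<Longrightarrow> b \<in> tangible G0 \<Longrightarrow> a * b \<in> tangible G0"
    and nu_onto: "\<nu> ` tangible G0 = G0 - {0}"

(* Meant for square matrices only. *)
definition trop_det :: "'a::comm_semiring_1 mat \<Rightarrow> 'a" where
  "trop_det A = (\<Sum>p | p permutes {0..<dim_row A}. \<Prod>i = 0..<dim_row A. A $$ (i, p i))"

lemma trop_det_empty: "trop_det (mat 0 0 f) = 1"
  by (simp add: trop_det_def)

definition nonsingular :: "'a::comm_semiring_1 set \<Rightarrow> 'a mat \<Rightarrow> bool" where
  "nonsingular G0 A \<longleftrightarrow> trop_det A \<in> tangible G0"

definition trop_adj :: "'a::comm_semiring_1 mat \<Rightarrow> 'a mat" where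
  "trop_adj A = transpose_mat
     (mat (dim_row A) (dim_col A) (\<lambda>(i, j). trop_det (mat_delete A i j)))"

(* 1/a; meaningful only for invertible a, that is, for a dvd 1. *)
definition unit_inverse :: "'a::comm_semiring_1 \<Rightarrow> 'a" where
  "unit_inverse a = (THE b. a * b = 1)"

lemma unit_inverse:
  assumes "a dvd 1"
  shows "a * unit_inverse a = 1"
proof -
  obtain b where b: "a * b = 1"
    using assms by (metis dvdE)
  moreover have "c = b" if "a * c = 1" for c
    using that b by (metis mult.left_commute mult.right_neutral)
  ultimately show ?thesis
    unfolding unit_inverse_def by (rule theI)
qed

definition trop_nabla :: "'a::comm_semiring_1 mat \<Rightarrow> 'a mat" where
  "trop_nabla A = unit_inverse (trop_det A) \<cdot>\<^sub>m trop_adj A"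

definition quasi_zero :: "'a::comm_semiring_1 set \<Rightarrow> nat \<Rightarrow> 'a mat \<Rightarrow> bool" where
  "quasi_zero G0 n Z \<longleftrightarrow> Z \<in> carrier_mat n n \<and>
     (\<forall>i<n. Z $$ (i, i) = 0) \<and> (\<forall>i<n. \<forall>j<n. i \<noteq> j \<longrightarrow> Z $$ (i, j) \<in> G0)"

definition quasi_identity :: "'a::comm_semiring_1 set \<Rightarrow> nat \<Rightarrow> 'a mat \<Rightarrow> bool" where
  "quasi_identity G0 n B \<longleftrightarrow> nonsingular G0 B \<and> B * B = B \<and>
     (\<exists>Z. quasi_zero G0 n Z \<and> B = 1\<^sub>m n + Z)"

(* B is a quasi-inverse for A. *)
definition quasi_inverse :: "'a::comm_semiring_1 set \<Rightarrow> nat \<Rightarrow> 'a mat \<Rightarrow> 'a mat \<Rightarrow> bool" where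
  "quasi_inverse G0 n B A \<longleftrightarrow> A \<in> carrier_mat n n \<and> B \<in> carrier_mat n n \<and>
     quasi_identity G0 n (A * B) \<and> quasi_identity G0 n (B * A)"

end

theory Submission
  imports Defs
begin

text \<open>
  An invertible \<open>|A|\<close> is tangible, and a tangible sum equals one of its terms, whose ghost value
  strictly exceeds that of every other term (\<open>tangible_sum_dominant\<close>). So \<open>|A|\<close> is the product along a
  single permutation \<open>\<sigma>\<close>, and the entries \<open>A(y, \<sigma> y)\<close>, as divisors of a unit, are units. Permuting
  the columns by \<open>\<sigma>\<close> and dividing each by its new diagonal entry gives \<open>A = C Q\<close>, where \<open>Q\<close> is a
  monomial matrix and \<open>C\<close> has \<open>1\<close> on the diagonal and permutation products strictly below \<open>1\<close> away from
  the identity. The scaling factors cancel in \<open>A A\<^sup>\<nabla> = C adj(C)\<close>.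
  
  Read \<open>C\<close> as a weighted digraph. Its cycles on at least two vertices are nonidentity permutations, so
  they weigh less than \<open>1\<close>. A term of the \<open>(i, j)\<close> entry of \<open>adj(C)\<close> is a path from \<open>i\<close> to \<open>j\<close> together
  with disjoint cycles, hence lies below the weight of a walk (\<open>term_le_walk\<close>). Conversely, removing
  cycles from a walk does not decrease its weight, so each walk lies below the entry
  (\<open>walk_le_adj\<close>). Up to ghost value the adjoint is therefore the matrix of optimal walk weights.
  Concatenating walks gives \<open>adj(C)\<^sub>i\<^sub>k adj(C)\<^sub>k\<^sub>j \<preceq> adj(C)\<^sub>i\<^sub>j\<close>, and a closed walk through two different
  vertices weighs less than \<open>1\<close>.
  
  The matrix \<open>B = C adj(C)\<close> has the same ghost values as \<open>adj(C)\<close>. Its diagonal entries are \<open>|C| = 1\<close>.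
  An off-diagonal entry is the determinant of a matrix with two equal rows, whose terms occur in equal
  pairs, so it is a ghost. Then \<open>B\<^sup>2 = B\<close>: off the diagonal both sides are ghosts of the same value, and
  on the diagonal \<open>1\<close> absorbs the closed walks. Shortcutting the cycles of a permutation shows that
  \<open>|B| = 1\<close> as well (\<open>quasi_identityI\<close>). The product \<open>A\<^sup>\<nabla> A\<close> follows by transposition.
\<close>

section \<open>Comparing ghost values\<close>

context supertropical_semiring
begin

text \<open>
  The order of ghost values, pulled back to a total preorder on the whole semiring. It replaces equality
  of ghosts by two inequalities and lets \<open>\<prec>\<close> express that a summand is absorbed.
  
  The semiring need not be cancellative, so \<open>a \<prec> b\<close> need not give \<open>a * c \<prec> b * c\<close>. Strict bounds are
  therefore obtained by multiplying \<open>a \<prec> 1\<close> by factors that are \<open>\<preceq> 1\<close>.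
\<close>

definition ghost_le :: "'a \<Rightarrow> 'a \<Rightarrow> bool" (infix "\<preceq>" 50) where
  "a \<preceq> b \<longleftrightarrow> \<nu> a + \<nu> b = \<nu> b"

definition ghost_less :: "'a \<Rightarrow> 'a \<Rightarrow> bool" (infix "\<prec>" 50) where
  "a \<prec> b \<longleftrightarrow> \<not> b \<preceq> a"

lemma nu_zero: "\<nu> 0 = 0"
  by (simp add: nu_eq)

lemma nu_add_self: "\<nu> a + \<nu> a = \<nu> a"
  using nu_eq[of "\<nu> a"] by (simp add: nu_idem)

lemma ghost_le_refl: "a \<preceq> a"
  by (simp add: ghost_le_def nu_add_self)

lemma ghost_le_trans: "a \<preceq> b \<Longrightarrow> b \<preceq> c \<Longrightarrow> a \<preceq> c"
  unfolding ghost_le_def by (metis add.assoc)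

lemma ghost_le_linear: "a \<preceq> b \<or> b \<preceq> a"
  unfolding ghost_le_def
  using add_nu_eq[of "\<nu> a" "\<nu> b"] add_nu_neq[of "\<nu> a" "\<nu> b"]
  by (cases "\<nu> a = \<nu> b") (auto simp: nu_idem nu_add_self add.commute[of "\<nu> b"])

lemma ghost_le_antisym: "a \<preceq> b \<Longrightarrow> b \<preceq> a \<Longrightarrow> \<nu> a = \<nu> b"
  unfolding ghost_le_def by (metis add.commute)

lemma ghost_less_imp_le: "a \<prec> b \<Longrightarrow> a \<preceq> b"
  unfolding ghost_less_def using ghost_le_linear by blast

lemma ghost_le_less_trans: "a \<preceq> b \<Longrightarrow> b \<prec> c \<Longrightarrow> a \<prec> c"
  unfolding ghost_less_def using ghost_le_trans by blast

lemma ghost_le_zero: "0 \<preceq> a"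
  by (simp add: ghost_le_def nu_zero)

lemma zero_ghost_less_one: "0 \<prec> 1"
proof -
  have "\<nu> 1 \<noteq> 0"
  proof
    assume "\<nu> 1 = 0"
    then have "(1::'a) + 0 = 0"
      using add_nu_eq[of 1 0] by (simp add: nu_zero)
    then show False by simp
  qed
  then show ?thesis
    by (simp add: ghost_less_def ghost_le_def nu_zero)
qed

lemma ghost_le_mult_right: "a \<preceq> b \<Longrightarrow> a * c \<preceq> b * c"
  unfolding ghost_le_def nu_mult by (metis distrib_right)

lemma ghost_le_mult: "a \<preceq> b \<Longrightarrow> c \<preceq> d \<Longrightarrow> a * c \<preceq> b * d"
  using ghost_le_mult_right[of a b c] ghost_le_mult_right[of c d b]
  by (metis ghost_le_trans mult.commute)

lemma ghost_le_add_left: "a \<preceq> a + b"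
  unfolding ghost_le_def nu_add by (metis add.assoc nu_add_self)

lemma ghost_le_addI: "a \<preceq> c \<Longrightarrow> b \<preceq> c \<Longrightarrow> a + b \<preceq> c"
  unfolding ghost_le_def nu_add by (metis add.assoc)

lemma ghost_less_addI:
  assumes "a \<prec> c" "b \<prec> c"
  shows "a + b \<prec> c"
proof (cases "a \<preceq> b")
  case True
  then have "a + b \<preceq> b" by (simp add: ghost_le_addI ghost_le_refl)
  then show ?thesis using assms(2) ghost_le_less_trans by blast
next
  case False
  then have "a + b \<preceq> a" using ghost_le_linear[of a b] by (simp add: ghost_le_addI ghost_le_refl)
  then show ?thesis using assms(1) ghost_le_less_trans by blast
qed

lemma ghost_le_sumI: "(\<And>x. x \<in> F \<Longrightarrow> f x \<preceq> b) \<Longrightarrow> sum f F \<preceq> b"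
  by (induction F rule: infinite_finite_induct) (auto simp: ghost_le_zero ghost_le_addI)

lemma ghost_less_sumI:
  "(\<And>x. x \<in> F \<Longrightarrow> f x \<prec> b) \<Longrightarrow> 0 \<prec> b \<Longrightarrow> sum f F \<prec> b"
  by (induction F rule: infinite_finite_induct) (auto simp: ghost_less_addI)

lemma ghost_le_sum_member: "finite F \<Longrightarrow> x \<in> F \<Longrightarrow> f x \<preceq> sum f F"
  by (simp add: sum.remove[of F x] ghost_le_add_left)

lemma sum_ghost: "(\<And>x. x \<in> F \<Longrightarrow> f x \<in> G0) \<Longrightarrow> sum f F \<in> G0"
  by (induction F rule: infinite_finite_induct) (auto simp: zero_ghost add_ghost)

lemma ghost_eqI: "a \<in> G0 \<Longrightarrow> b \<in> G0 \<Longrightarrow> a \<preceq> b \<Longrightarrow> b \<preceq> a \<Longrightarrow> a = b"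
  using ghost_le_antisym nu_id by metis

lemma add_absorb:
  assumes "b \<prec> a"
  shows "a + b = a"
proof -
  have "\<nu> a \<noteq> \<nu> b"
    using assms by (auto simp: ghost_less_def ghost_le_def nu_add_self)
  moreover have "a + b \<noteq> b"
    using assms ghost_le_add_left[of a b] by (auto simp: ghost_less_def)
  ultimately show ?thesis
    using add_nu_neq by blast
qed

lemma sum_absorb:
  assumes "finite F" "i \<in> F" and less: "\<And>x. x \<in> F \<Longrightarrow> x \<noteq> i \<Longrightarrow> f x \<prec> f i"
  shows "sum f F = f i"
proof -
  have "f i + sum f E = f i" if "finite E" "E \<subseteq> F - {i}" for E
    using that
  proof (induction E rule: finite_induct)
    case (insert x E)
    then have "f i + (f x + sum f E) = f i + f x"
      by (metis add.left_commute add.commute insert_subset)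
    also have "\<dots> = f i"
      using insert by (intro add_absorb less) auto
    finally show ?case using insert by simp
  qed simp
  then show ?thesis
    using assms by (simp add: sum.remove[of F i])
qed

text \<open>
  Adding two elements of equal ghost value gives a ghost. So if \<open>f y + s\<close> is tangible, then either
  \<open>f y\<close> absorbs \<open>s\<close>, and dominates every term of \<open>s\<close>, or \<open>s\<close> absorbs \<open>f y\<close> and is itself tangible.
\<close>

lemma tangible_sum_dominant:
  assumes "finite F" "sum f F \<in> tangible G0"
  shows "\<exists>i\<in>F. sum f F = f i \<and> (\<forall>x\<in>F. x \<noteq> i \<longrightarrow> f x \<prec> f i)"
  using assms
proof (induction F rule: finite_induct)
  case empty
  then show ?case by (simp add: tangible_def zero_ghost)
next
  case (insert y F)
  let ?s = "sum f F"
  have tang: "f y + ?s \<in> tangible G0"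
    using insert by simp
  have neq: "\<nu> (f y) \<noteq> \<nu> ?s"
    using tang add_nu_eq nu_ghost by (metis DiffD2 tangible_def)
  show ?case
  proof (cases "?s \<preceq> f y")
    case True
    then have less: "?s \<prec> f y"
      using neq ghost_le_antisym by (auto simp: ghost_less_def)
    have "f x \<prec> f y" if "x \<in> F" for x
      using ghost_le_less_trans[OF ghost_le_sum_member less] that insert.hyps by simp
    then show ?thesis
      using insert.hyps add_absorb[OF less] by auto
  next
    case False
    then have less: "f y \<prec> ?s"
      by (simp add: ghost_less_def)
    then have "f y + ?s = ?s"
      using add_absorb by (simp add: add.commute)
    then obtain i where "i \<in> F" "?s = f i" "\<forall>x\<in>F. x \<noteq> i \<longrightarrow> f x \<prec> f i"
      using insert.IH tang by auto
    then show ?thesis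
      using insert.hyps less \<open>f y + ?s = ?s\<close> by auto
  qed
qed

end

section \<open>Matrices with transitive entries\<close>

text \<open>
  If \<open>i \<rightarrow> k \<rightarrow> l\<close> are consecutive in a cycle of \<open>p\<close>, replacing these two steps by \<open>i \<rightarrow> l\<close> and the loop at
  \<open>k\<close> does not decrease the product, by transitivity, and \<open>k\<close> becomes a fixed point. Repeating this
  ends in a two-cycle, which is strictly below \<open>1\<close>.
\<close>

lemma (in supertropical_semiring) permutation_product_less_one:
  assumes "finite U" and diag: "\<And>i. i \<in> U \<Longrightarrow> b i i = 1"
    and trans: "\<And>i j k. i \<in> U \<Longrightarrow> j \<in> U \<Longrightarrow> k \<in> U \<Longrightarrow> b i k * b k j \<preceq> b i j"
    and cycle: "\<And>i k. i \<in> U \<Longrightarrow> k \<in> U \<Longrightarrow> i \<noteq> k \<Longrightarrow> b i k * b k i \<prec> 1"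
    and "p permutes U" "p \<noteq> id"
  shows "(\<Prod>x\<in>U. b x (p x)) \<prec> 1"
  using assms(5,6)
proof (induction "card {x. p x \<noteq> x}" arbitrary: p rule: less_induct)
  case less
  obtain i where "p i \<noteq> i"
    using less.prems by (metis eq_id_iff)
  define k where "k = p i"
  have iU: "i \<in> U" and kU: "k \<in> U" and pkU: "p k \<in> U" and ik: "i \<noteq> k"
    using \<open>p i \<noteq> i\<close> less.prems permutes_not_in permutes_in_image unfolding k_def by metis+
  \<comment> \<open>\<open>q\<close> sends \<open>i\<close> directly to \<open>p k\<close> and fixes \<open>k\<close>.\<close>
  define q where "q = p \<circ> transpose i k"
  have q: "q permutes U"
    unfolding q_def using less.prems iU kU by (intro permutes_compose permutes_swap_id)
  have pk: "p k \<noteq> k"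
    using ik less.prems permutes_inj unfolding k_def by (metis injD)
  have qi: "q i = p k" "q k = k" and q_other: "\<And>x. x \<noteq> i \<Longrightarrow> x \<noteq> k \<Longrightarrow> q x = p x"
    by (auto simp: q_def k_def)
  let ?rest = "\<Prod>x\<in>U - {i} - {k}. b x (p x)"
  have split: "(\<Prod>x\<in>U. b x (r x)) = b i (r i) * b k (r k) * (\<Prod>x\<in>U - {i} - {k}. b x (r x))" for r
    using assms(1) iU kU ik by (simp add: prod.remove[of U i] prod.remove[of "U - {i}" k] mult.assoc)
  have prod_q: "(\<Prod>x\<in>U. b x (q x)) = b i (p k) * ?rest"
  proof -
    have "(\<Prod>x\<in>U - {i} - {k}. b x (q x)) = ?rest"
      by (intro prod.cong) (auto simp: q_other)
    then show ?thesis
      unfolding split[of q] using qi diag kU by simp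
  qed
  have "finite {x. p x \<noteq> x}"
    by (rule finite_subset[OF _ assms(1)]) (use permutes_not_in[OF less.prems(1)] in blast)
  then have smaller: "card {x. q x \<noteq> x} < card {x. p x \<noteq> x}"
  proof (rule psubset_card_mono)
    have "{x. q x \<noteq> x} \<subseteq> {x. p x \<noteq> x} - {k}"
      using qi q_other \<open>p i \<noteq> i\<close> by fastforce
    then show "{x. q x \<noteq> x} \<subset> {x. p x \<noteq> x}"
      using pk by auto
  qed
  have prod_p: "(\<Prod>x\<in>U. b x (p x)) = b i k * b k (p k) * ?rest"
    unfolding split[of p] by (simp add: k_def)
  show ?case
  proof (cases "p k = i")
    case True
    have "?rest \<preceq> 1"
    proof (cases "q = id")
      case True
      then show ?thesis
        using prod_q diag iU \<open>p k = i\<close> by (simp add: ghost_le_refl)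
    next
      case False
      then show ?thesis
        using less.hyps[OF smaller q] prod_q diag iU \<open>p k = i\<close> by (simp add: ghost_less_imp_le)
    qed
    then have "b i k * b k i * ?rest \<preceq> b i k * b k i"
      using ghost_le_mult[OF ghost_le_refl] by fastforce
    then show ?thesis
      unfolding prod_p True using cycle iU kU ik ghost_le_less_trans by blast
  next
    case False
    then have "q \<noteq> id"
      using qi by auto
    then have "b i (p k) * ?rest \<prec> 1"
      using less.hyps[OF smaller q] prod_q by simp
    moreover have "b i k * b k (p k) * ?rest \<preceq> b i (p k) * ?rest"
      using trans iU kU pkU by (intro ghost_le_mult_right) auto
    ultimately show ?thesis
      unfolding prod_p using ghost_le_less_trans by blast
  qed
qed

text \<open>
  The strict bound on two-cycles makes \<open>1\<close> absorb the other terms in the diagonal of \<open>B * B\<close> and,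
  together with transitivity, in the determinant. Off the diagonal, the ghost \<open>B(i, j)\<close> occurs in the
  sum for \<open>(B * B)(i, j)\<close> and, by transitivity, dominates all its terms.
\<close>

lemma (in supertropical_domain) quasi_identityI:
  assumes B: "B \<in> carrier_mat n n"
    and diag: "\<And>i. i < n \<Longrightarrow> B $$ (i, i) = 1"
    and ghost: "\<And>i j. i < n \<Longrightarrow> j < n \<Longrightarrow> i \<noteq> j \<Longrightarrow> B $$ (i, j) \<in> G0"
    and trans: "\<And>i j k. i < n \<Longrightarrow> j < n \<Longrightarrow> k < n \<Longrightarrow> B $$ (i, k) * B $$ (k, j) \<preceq> B $$ (i, j)"
    and cycle: "\<And>i k. i < n \<Longrightarrow> k < n \<Longrightarrow> i \<noteq> k \<Longrightarrow> B $$ (i, k) * B $$ (k, i) \<prec> 1"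
  shows "quasi_identity G0 n B"
proof -
  have "trop_det B = (\<Prod>x = 0..<n. B $$ (x, id x))"
    unfolding trop_det_def carrier_matD(1)[OF B]
  proof (rule sum_absorb)
    fix p assume "p \<in> {p. p permutes {0..<n}}" "p \<noteq> id"
    then have "(\<Prod>x = 0..<n. B $$ (x, p x)) \<prec> 1"
      using diag trans cycle by (intro permutation_product_less_one) auto
    then show "(\<Prod>x = 0..<n. B $$ (x, p x)) \<prec> (\<Prod>x = 0..<n. B $$ (x, id x))"
      using diag by simp
  qed (use finite_permutations[of "{0..<n}"] permutes_id in blast)+
  then have "nonsingular G0 B"
    using diag one_tangible by (simp add: nonsingular_def)
  moreover have "B * B = B"
  proof (rule eq_matI)
    fix i j assume "i < dim_row B" "j < dim_col B"
    then have ij: "i < n" "j < n" using B by auto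
    have entry: "(B * B) $$ (i, j) = (\<Sum>k = 0..<n. B $$ (i, k) * B $$ (k, j))"
      using B ij by (simp add: scalar_prod_def)
    show "(B * B) $$ (i, j) = B $$ (i, j)"
    proof (cases "i = j")
      case True
      \<comment> \<open>The term \<open>k = i\<close> is \<open>1\<close> and absorbs the two-cycles through \<open>i\<close>.\<close>
      have "(\<Sum>k = 0..<n. B $$ (i, k) * B $$ (k, i)) = B $$ (i, i) * B $$ (i, i)"
        using ij cycle diag by (intro sum_absorb) auto
      then show ?thesis
        using entry True diag ij by simp
    next
      case False
      \<comment> \<open>For \<open>i \<noteq> j\<close> one of the two factors is off the diagonal, so each term is a ghost.\<close>
      have mem: "B $$ (i, k) * B $$ (k, j) \<in> G0" if "k < n" for k
        using False ghost mult_ghost that ij by (metis mult.commute)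
      have "B $$ (i, i) * B $$ (i, j) \<preceq> (\<Sum>k = 0..<n. B $$ (i, k) * B $$ (k, j))"
        by (rule ghost_le_sum_member) (use ij in auto)
      then have "B $$ (i, j) \<preceq> (\<Sum>k = 0..<n. B $$ (i, k) * B $$ (k, j))"
        using diag[OF ij(1)] by simp
      moreover have "(\<Sum>k = 0..<n. B $$ (i, k) * B $$ (k, j)) \<preceq> B $$ (i, j)"
        using ij trans by (intro ghost_le_sumI) simp
      moreover have "(\<Sum>k = 0..<n. B $$ (i, k) * B $$ (k, j)) \<in> G0"
        using mem by (intro sum_ghost) simp
      ultimately show ?thesis
        unfolding entry using ghost[OF ij False] by (intro ghost_eqI)
    qed
  qed (use B in auto)
  moreover have "\<exists>Z. quasi_zero G0 n Z \<and> B = 1\<^sub>m n + Z"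
  proof (intro exI conjI)
    let ?Z = "mat n n (\<lambda>(i, j). if i = j then 0 else B $$ (i, j))"
    show "quasi_zero G0 n ?Z"
      using ghost by (auto simp: quasi_zero_def)
    show "B = 1\<^sub>m n + ?Z"
      using B diag by (intro eq_matI) auto
  qed
  ultimately show ?thesis
    by (simp add: quasi_identity_def)
qed

section \<open>The adjoint and walks\<close>

text \<open>
  The \<open>(i, j)\<close> entry of the adjoint of \<open>c\<close>. Instead of deleting row \<open>j\<close> and column \<open>i\<close> it sums over the
  permutations of the full index set that use the position \<open>(j, i)\<close>, and leaves out the factor there:
  such a permutation is a path from \<open>i\<close> to \<open>j\<close> with disjoint cycles, closed up by the edge from \<open>j\<close> to \<open>i\<close>.
\<close>

definition adj_entry :: "'i set \<Rightarrow> ('i \<Rightarrow> 'i \<Rightarrow> 'a::comm_semiring_1) \<Rightarrow> 'i \<Rightarrow> 'i \<Rightarrow> 'a" where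
  "adj_entry U c i j = (\<Sum>p | p permutes U \<and> p j = i. \<Prod>x\<in>U - {j}. c x (p x))"

fun walk_weight :: "('i \<Rightarrow> 'i \<Rightarrow> 'a::comm_semiring_1) \<Rightarrow> 'i list \<Rightarrow> 'a" where
  "walk_weight c (x # y # zs) = c x y * walk_weight c (y # zs)"
| "walk_weight c _ = 1"

lemma walk_weight_join:
  "walk_weight c (xs @ y # ys) = walk_weight c (xs @ [y]) * walk_weight c (y # ys)"
proof (induction xs)
  case (Cons x xs)
  then show ?case by (cases xs) (auto simp: mult.assoc)
qed simp

lemma walk_weight_snoc:
  "xs \<noteq> [] \<Longrightarrow> walk_weight c (xs @ [y]) = walk_weight c xs * c (last xs) y"
proof (induction xs)
  case (Cons x xs)
  then show ?case by (cases xs) (auto simp: mult.assoc)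
qed simp

text \<open>
  The cyclic permutation along the path, built from the end: composing with \<open>transpose x (last ys)\<close>
  inserts \<open>x\<close> in front of the path \<open>ys\<close>.
\<close>

lemma distinct_walk_permutation:
  assumes "distinct xs" "xs \<noteq> []"
  shows "\<exists>q. q permutes set xs \<and> q (last xs) = hd xs \<and>
    (\<Prod>x\<in>set xs - {last xs}. c x (q x)) = walk_weight c xs"
  using assms
proof (induction c xs rule: walk_weight.induct)
  case (1 c x y zs)
  let ?l = "last (y # zs)"
  have l: "?l \<in> set (y # zs)" by (rule last_in_set) simp
  have x: "x \<notin> set (y # zs)" using "1.prems" by simp
  obtain q where q: "q permutes set (y # zs)" "q ?l = y"
    "(\<Prod>z\<in>set (y # zs) - {?l}. c z (q z)) = walk_weight c (y # zs)"
    using 1 by auto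
  let ?r = "q \<circ> transpose x ?l"
  have "?r permutes set (x # y # zs)"
    using l by (intro permutes_compose permutes_swap_id permutes_subset[OF q(1)]) auto
  moreover have "?r ?l = x"
    using permutes_not_in[OF q(1) x] by simp
  moreover have "(\<Prod>z\<in>set (x # y # zs) - {?l}. c z (?r z)) = walk_weight c (x # y # zs)"
  proof -
    have "set (x # y # zs) - {?l} = insert x (set (y # zs) - {?l})"
      using l x by auto
    moreover have "(\<Prod>z\<in>set (y # zs) - {?l}. c z (?r z)) = (\<Prod>z\<in>set (y # zs) - {?l}. c z (q z))"
      using x by (intro prod.cong) (auto simp: transpose_def)
    ultimately show ?thesis
      using x q by simp
  qed
  moreover have "last (x # y # zs) = ?l" "hd (x # y # zs) = x"
    by simp_all
  ultimately show ?case
    by (metis (no_types))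
qed (auto intro: exI[of _ id] simp: permutes_id)

text \<open>
  The matrix \<open>C\<close> after normalization by its dominant permutation: the identity is the only permutation
  whose product is not strictly below \<open>1\<close>. Indices are naturals because their order is used to choose
  one permutation from each pair in \<open>times_adj_ghost\<close>.
\<close>

locale normalized_matrix = supertropical_semiring G0 \<nu>
  for G0 :: "'a::comm_semiring_1 set" and \<nu> +
  fixes U :: "nat set" and c :: "nat \<Rightarrow> nat \<Rightarrow> 'a"
  assumes finite_U: "finite U"
    and diag_one: "x \<in> U \<Longrightarrow> c x x = 1"
    and permutation_less_one: "p permutes U \<Longrightarrow> p \<noteq> id \<Longrightarrow> (\<Prod>x\<in>U. c x (p x)) \<prec> 1"
begin

abbreviation adj where
  "adj \<equiv> adj_entry U c"

lemma permutation_le_one: "p permutes U \<Longrightarrow> (\<Prod>x\<in>U. c x (p x)) \<preceq> 1"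
  using permutation_less_one[of p] diag_one ghost_less_imp_le
  by (cases "p = id") (auto simp: ghost_le_refl)

lemma permutation_product_extend:
  assumes "q permutes V" "V \<subseteq> U" "j \<in> V"
  shows "(\<Prod>x\<in>U - {j}. c x (q x)) = (\<Prod>x\<in>V - {j}. c x (q x))"
proof (rule prod.mono_neutral_right)
  show "\<forall>x\<in>U - {j} - (V - {j}). c x (q x) = 1"
    using permutes_not_in[OF assms(1)] diag_one by (metis DiffE DiffI)
qed (use assms finite_U in auto)

lemma finite_perms: "finite {p. p permutes U \<and> P p}"
  using finite_permutations[OF finite_U] by (rule rev_finite_subset) auto

lemma term_le_adj: "p permutes U \<Longrightarrow> (\<Prod>x\<in>U - {j}. c x (p x)) \<preceq> adj (p j) j"
  unfolding adj_entry_def by (rule ghost_le_sum_member) (auto simp: finite_perms)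

lemma distinct_walk_le_adj:
  assumes "distinct xs" "xs \<noteq> []" "set xs \<subseteq> U"
  shows "walk_weight c xs \<preceq> adj (hd xs) (last xs)"
proof -
  obtain q where q: "q permutes set xs" "q (last xs) = hd xs"
    "(\<Prod>x\<in>set xs - {last xs}. c x (q x)) = walk_weight c xs"
    using distinct_walk_permutation[OF assms(1,2)] by blast
  then show ?thesis
    using term_le_adj[OF permutes_subset[OF q(1) assms(3)], of "last xs"]
      permutation_product_extend[OF q(1) assms(3)] assms(2) by simp
qed

text \<open>
  Closing the paths from \<open>i\<close> to \<open>j\<close> by the edge from \<open>j\<close> to \<open>i\<close> restores the omitted factor, so that
  bounds on permutation products apply.
\<close>

lemma edge_adj_eq:
  assumes "j \<in> U"
  shows "c j i * adj i j = (\<Sum>p | p permutes U \<and> p j = i. \<Prod>x\<in>U. c x (p x))"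
  unfolding adj_entry_def sum_distrib_left
  using assms finite_U by (intro sum.cong) (auto simp: prod.remove[of U j])

lemma edge_adj_le_one: "j \<in> U \<Longrightarrow> c j i * adj i j \<preceq> 1"
  unfolding edge_adj_eq by (rule ghost_le_sumI) (auto intro: permutation_le_one)

lemma edge_adj_less_one:
  assumes "j \<in> U" "i \<noteq> j"
  shows "c j i * adj i j \<prec> 1"
  unfolding edge_adj_eq[OF assms(1)]
  using assms(2) by (intro ghost_less_sumI permutation_less_one zero_ghost_less_one) auto

text \<open>
  A repeated vertex \<open>y\<close> splits off a closed walk. Without its last edge that walk is shorter, so by
  induction it lies below an entry of the adjoint, and closing it up again gives at most \<open>1\<close>.
  Cutting it out leaves a shorter walk of at least the same weight.
\<close>

lemma walk_le_adj: "xs \<noteq> [] \<Longrightarrow> set xs \<subseteq> U \<Longrightarrow> walk_weight c xs \<preceq> adj (hd xs) (last xs)"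
proof (induction xs rule: length_induct)
  case (1 xs)
  show ?case
  proof (cases "distinct xs")
    case True
    then show ?thesis using 1 distinct_walk_le_adj by blast
  next
    case False
    then obtain as bs cs y where xs: "xs = as @ [y] @ bs @ [y] @ cs"
      using not_distinct_decomp by blast
    let ?l = "last (y # bs)"
    have "walk_weight c (y # bs) \<preceq> adj y ?l"
      using 1 xs by (auto dest!: spec[of _ "y # bs"])
    then have "walk_weight c ((y # bs) @ [y]) \<preceq> c ?l y * adj y ?l"
      using ghost_le_mult_right by (subst walk_weight_snoc) (simp_all add: mult.commute[of "c _ _"])
    moreover have "?l \<in> U"
      using 1(3) xs last_in_set[of "y # bs"] by auto
    ultimately have closed: "walk_weight c (y # bs @ [y]) \<preceq> 1"
      using edge_adj_le_one ghost_le_trans by fastforce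
    have "walk_weight c xs
        = walk_weight c (y # bs @ [y]) * (walk_weight c (as @ [y]) * walk_weight c (y # cs))"
      using walk_weight_join[of c as y "bs @ y # cs"] walk_weight_join[of c "y # bs" y cs]
      by (simp add: xs ac_simps)
    also have "\<dots> = walk_weight c (y # bs @ [y]) * walk_weight c (as @ y # cs)"
      by (metis walk_weight_join)
    also have "\<dots> \<preceq> walk_weight c (as @ y # cs)"
      using ghost_le_mult_right[OF closed] by simp
    finally have "walk_weight c xs \<preceq> walk_weight c (as @ y # cs)" .
    moreover have "walk_weight c (as @ y # cs) \<preceq> adj (hd (as @ y # cs)) (last (as @ y # cs))"
      using 1 xs by (auto dest!: spec[of _ "as @ y # cs"])
    moreover have "hd (as @ y # cs) = hd xs" "last (as @ y # cs) = last xs"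
      unfolding xs by (cases as; simp)+
    ultimately show ?thesis
      using ghost_le_trans by metis
  qed
qed

text \<open>
  Induction on the vertex set peels off the first vertex \<open>i = p j\<close> of the path: redirecting \<open>j\<close> to
  \<open>p i\<close> yields a permutation of \<open>V - {i}\<close>. When \<open>j\<close> is fixed the walk is trivial and only cycles remain,
  whose product is at most \<open>1\<close>.
\<close>

lemma term_le_walk:
  assumes "p permutes V" "V \<subseteq> U" "j \<in> V"
  shows "\<exists>xs. xs \<noteq> [] \<and> set xs \<subseteq> V \<and> hd xs = p j \<and> last xs = j \<and>
    (\<Prod>x\<in>V - {j}. c x (p x)) \<preceq> walk_weight c xs"
  using assms
proof (induction "card V" arbitrary: p V rule: less_induct)
  case less
  have fin: "finite V"
    using less.prems finite_U finite_subset by blast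
  show ?case
  proof (cases "p j = j")
    case True
    have "(\<Prod>x\<in>V - {j}. c x (p x)) = (\<Prod>x\<in>U - {j}. c x (p x))"
      using permutation_product_extend less.prems by simp
    also have "\<dots> = (\<Prod>x\<in>U. c x (p x))"
      using less.prems True finite_U diag_one by (subst prod.remove[of U j]) auto
    also have "\<dots> \<preceq> 1"
      using less.prems permutes_subset permutation_le_one by blast
    finally show ?thesis
      using True less.prems by (intro exI[of _ "[j]"]) auto
  next
    case False
    define i where "i = p j"
    have i: "i \<in> V" "i \<noteq> j"
      using less.prems False permutes_in_image unfolding i_def by metis+
    define q where "q = p \<circ> transpose i j"
    have "q permutes V"
      unfolding q_def using less.prems i by (intro permutes_compose permutes_swap_id) auto
    moreover have "q i = i" "q j = p i"
      by (auto simp: q_def i_def)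
    ultimately have q: "q permutes V - {i}"
      by (auto intro: permutes_superset)
    have "card (V - {i}) < card V"
      using i fin by (intro card_Diff1_less)
    then obtain xs where xs: "xs \<noteq> []" "set xs \<subseteq> V - {i}" "hd xs = p i" "last xs = j"
      "(\<Prod>x\<in>V - {i} - {j}. c x (q x)) \<preceq> walk_weight c xs"
      using less.hyps[OF _ q] less.prems i \<open>q j = p i\<close> by auto
    have "(\<Prod>x\<in>V - {j}. c x (p x)) = c i (p i) * (\<Prod>x\<in>V - {j} - {i}. c x (p x))"
      using i fin by (simp add: prod.remove[of "V - {j}" i])
    also have "(\<Prod>x\<in>V - {j} - {i}. c x (p x)) = (\<Prod>x\<in>V - {i} - {j}. c x (q x))"
      by (intro prod.cong) (auto simp: q_def transpose_def)
    also have "c i (p i) * \<dots> \<preceq> c i (p i) * walk_weight c xs"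
      using xs by (intro ghost_le_mult ghost_le_refl)
    also have "c i (p i) * walk_weight c xs = walk_weight c (i # xs)"
      using xs by (cases xs) auto
    finally show ?thesis
      using xs i by (intro exI[of _ "i # xs"]) (auto simp: i_def)
  qed
qed

text \<open>
  Each term of the product lies below a concatenation of two walks, which is again a walk.
\<close>

lemma adj_trans:
  assumes "i \<in> U" "j \<in> U" "k \<in> U"
  shows "adj i k * adj k j \<preceq> adj i j"
proof -
  have "(\<Prod>x\<in>U - {k}. c x (p x)) * (\<Prod>x\<in>U - {j}. c x (q x)) \<preceq> adj i j"
    if p: "p permutes U" "p k = i" and q: "q permutes U" "q j = k" for p q
  proof -
    obtain xs where xs: "xs \<noteq> []" "set xs \<subseteq> U" "hd xs = i" "last xs = k"
      "(\<Prod>x\<in>U - {k}. c x (p x)) \<preceq> walk_weight c xs"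
      using term_le_walk[OF p(1) _ assms(3)] p(2) by auto
    obtain ys where ys: "ys \<noteq> []" "set ys \<subseteq> U" "hd ys = k" "last ys = j"
      "(\<Prod>x\<in>U - {j}. c x (q x)) \<preceq> walk_weight c ys"
      using term_le_walk[OF q(1) _ assms(2)] q(2) by auto
    define zs where "zs = butlast xs @ ys"
    have xs_eq: "xs = butlast xs @ [k]" and ys_eq: "ys = k # tl ys"
      using xs ys by (metis append_butlast_last_id, metis list.collapse)
    have "walk_weight c zs = walk_weight c xs * walk_weight c ys"
      unfolding zs_def by (metis walk_weight_join xs_eq ys_eq)
    moreover have "hd zs = i" "last zs = j" "zs \<noteq> []" "set zs \<subseteq> U"
      using xs ys unfolding zs_def
      by (metis append_Nil hd_append xs_eq list.sel(1), auto dest: in_set_butlastD)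
    ultimately show ?thesis
      using walk_le_adj[of zs] ghost_le_mult[OF xs(5) ys(5)] ghost_le_trans by metis
  qed
  then show ?thesis
    unfolding adj_entry_def[of U c i k] adj_entry_def[of U c k j] sum_product
    by (intro ghost_le_sumI) auto
qed

lemma edge_le_adj: "i \<in> U \<Longrightarrow> j \<in> U \<Longrightarrow> c i j \<preceq> adj i j"
  using walk_le_adj[of "[i, j]"] by simp

lemma edge_adj_le_adj: "i \<in> U \<Longrightarrow> j \<in> U \<Longrightarrow> k \<in> U \<Longrightarrow> c i k * adj k j \<preceq> adj i j"
  using ghost_le_mult_right[OF edge_le_adj] adj_trans ghost_le_trans by blast

text \<open>
  Since \<open>i \<noteq> k\<close>, each path from \<open>i\<close> to \<open>k\<close> starts with a proper edge to some \<open>p i \<noteq> i\<close>. The rest of the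
  closed walk leads from \<open>p i\<close> back to \<open>i\<close>, and closing it by that edge uses nonidentity permutations
  only, which gives the strict bound.
\<close>

lemma adj_cycle_less_one:
  assumes "i \<in> U" "k \<in> U" "i \<noteq> k"
  shows "adj i k * adj k i \<prec> 1"
proof -
  have "(\<Prod>x\<in>U - {k}. c x (p x)) * adj k i \<prec> 1" if p: "p permutes U" "p k = i" for p
  proof -
    let ?q = "p \<circ> transpose i k"
    have pi: "p i \<in> U" "p i \<noteq> i"
      using p assms permutes_in_image permutes_inj by (metis, metis injD)
    have "(\<Prod>x\<in>U - {k}. c x (p x)) = c i (p i) * (\<Prod>x\<in>U - {k} - {i}. c x (p x))"
      using assms finite_U by (simp add: prod.remove[of "U - {k}" i])
    also have "(\<Prod>x\<in>U - {k} - {i}. c x (p x)) = (\<Prod>x\<in>U - {k} - {i}. c x (?q x))"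
      by (intro prod.cong) (auto simp: transpose_def)
    also have "\<dots> = (\<Prod>x\<in>U - {k}. c x (?q x))"
      using assms finite_U p diag_one by (subst prod.remove[of "U - {k}" i]) auto
    also have "c i (p i) * \<dots> \<preceq> c i (p i) * adj (p i) k"
      using term_le_adj[of ?q k] p assms
      by (intro ghost_le_mult ghost_le_refl) (auto simp: permutes_compose permutes_swap_id)
    finally have "(\<Prod>x\<in>U - {k}. c x (p x)) * adj k i \<preceq> c i (p i) * adj (p i) k * adj k i"
      by (rule ghost_le_mult_right)
    moreover have "c i (p i) * adj (p i) k * adj k i \<preceq> c i (p i) * adj (p i) i"
      unfolding mult.assoc using adj_trans pi assms by (intro ghost_le_mult ghost_le_refl)
    ultimately show ?thesis
      using edge_adj_less_one[OF assms(1) pi(2)] ghost_le_trans ghost_le_less_trans by blast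
  qed
  then show ?thesis
    unfolding adj_entry_def[of U c i k] sum_distrib_right
    by (intro ghost_less_sumI zero_ghost_less_one) auto
qed

definition times_adj :: "nat \<Rightarrow> nat \<Rightarrow> 'a" where
  "times_adj i j = (\<Sum>l\<in>U. c i l * adj l j)"

text \<open>
  The Laplace expansion of the matrix in which row \<open>i\<close> is copied over row \<open>j\<close>.
\<close>

lemma times_adj_expand:
  assumes "j \<in> U"
  shows "times_adj i j = (\<Sum>p | p permutes U. c i (p j) * (\<Prod>x\<in>U - {j}. c x (p x)))"
proof -
  have "times_adj i j
      = (\<Sum>l\<in>U. \<Sum>p\<in>{p \<in> {p. p permutes U}. p j = l}. c i (p j) * (\<Prod>x\<in>U - {j}. c x (p x)))"
    unfolding times_adj_def adj_entry_def sum_distrib_left by (intro sum.cong) auto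
  also have "\<dots> = (\<Sum>p | p permutes U. c i (p j) * (\<Prod>x\<in>U - {j}. c x (p x)))"
    using assms finite_permutations[OF finite_U] finite_U
    by (intro sum.group) (auto simp: permutes_in_image)
  finally show ?thesis .
qed

lemma times_adj_diag:
  assumes "j \<in> U"
  shows "times_adj j j = 1"
proof -
  have "times_adj j j = (\<Sum>p | p permutes U. \<Prod>x\<in>U. c x (p x))"
    unfolding times_adj_expand[OF assms]
    using assms finite_U by (intro sum.cong) (auto simp: prod.remove[of U j])
  also have "\<dots> = (\<Prod>x\<in>U. c x (id x))"
  proof (rule sum_absorb)
    fix p assume "p \<in> {p. p permutes U}" "p \<noteq> id"
    then show "(\<Prod>x\<in>U. c x (p x)) \<prec> (\<Prod>x\<in>U. c x (id x))"
      using permutation_less_one diag_one by simp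
  qed (use finite_permutations[OF finite_U] permutes_id in blast)+
  finally show ?thesis
    by (simp add: diag_one)
qed

text \<open>
  Rows \<open>i\<close> and \<open>j\<close> of the expanded determinant coincide, so \<open>p\<close> and \<open>p \<circ> transpose i j\<close> contribute
  equally. Splitting by the sign of \<open>p j - p i\<close> makes the sum of the form \<open>s + s\<close>, which is the ghost of \<open>s\<close>.
\<close>

lemma times_adj_ghost:
  assumes "i \<in> U" "j \<in> U" "i \<noteq> j"
  shows "times_adj i j \<in> G0"
proof -
  let ?t = "\<lambda>p. c i (p j) * (\<Prod>x\<in>U - {j}. c x (p x))"
  let ?swap = "\<lambda>p. p \<circ> transpose i j"
  let ?up = "{p. p permutes U \<and> p i < p j}" and ?down = "{p. p permutes U \<and> p j < p i}"
  have swap: "?swap p permutes U" if "p permutes U" for p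
    using that assms by (intro permutes_compose permutes_swap_id)
  have "p i \<noteq> p j" if "p permutes U" for p
    using that assms(3) permutes_inj injD by metis
  then have "{p. p permutes U} = ?up \<union> ?down"
    by (auto simp: neq_iff)
  then have "times_adj i j = sum ?t ?up + sum ?t ?down"
    unfolding times_adj_expand[OF assms(2)]
    by (simp only:) (rule sum.union_disjoint; auto simp: finite_perms)
  also have "sum ?t ?down = sum ?t ?up"
  proof (rule sum.reindex_bij_witness[of _ ?swap ?swap])
    fix p assume "p \<in> ?down"
    have split: "(\<Prod>x\<in>U - {j}. c x (r x)) = c i (r i) * (\<Prod>x\<in>U - {j} - {i}. c x (r x))" for r
      using assms finite_U by (simp add: prod.remove[of "U - {j}" i])
    have "(\<Prod>x\<in>U - {j} - {i}. c x (?swap p x)) = (\<Prod>x\<in>U - {j} - {i}. c x (p x))"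
      by (intro prod.cong) (auto simp: transpose_def)
    then show "?t (?swap p) = ?t p"
      unfolding split by (simp add: ac_simps)
  next
    fix p assume "p \<in> ?down"
    then show "?swap p \<in> ?up" "?swap (?swap p) = p"
      using swap[of p] by (simp_all add: comp_assoc)
  next
    fix p assume "p \<in> ?up"
    then show "?swap p \<in> ?down" "?swap (?swap p) = p"
      using swap[of p] by (simp_all add: comp_assoc)
  qed
  finally show ?thesis
    by (simp add: nu_ghost flip: nu_eq)
qed

lemma times_adj_le: "i \<in> U \<Longrightarrow> j \<in> U \<Longrightarrow> times_adj i j \<preceq> adj i j"
  unfolding times_adj_def by (intro ghost_le_sumI edge_adj_le_adj)

lemma adj_le_times_adj: "i \<in> U \<Longrightarrow> j \<in> U \<Longrightarrow> adj i j \<preceq> times_adj i j"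
  using ghost_le_sum_member[of U i "\<lambda>l. c i l * adj l j"] finite_U diag_one
  by (simp add: times_adj_def)

lemma times_adj_trans:
  "i \<in> U \<Longrightarrow> j \<in> U \<Longrightarrow> k \<in> U \<Longrightarrow> times_adj i k * times_adj k j \<preceq> times_adj i j"
  using ghost_le_mult[OF times_adj_le times_adj_le] adj_trans adj_le_times_adj ghost_le_trans
  by meson

lemma times_adj_cycle_less_one:
  "i \<in> U \<Longrightarrow> k \<in> U \<Longrightarrow> i \<noteq> k \<Longrightarrow> times_adj i k * times_adj k i \<prec> 1"
  using ghost_le_mult[OF times_adj_le times_adj_le] adj_cycle_less_one ghost_le_less_trans
  by meson

end

section \<open>Tropical minors and transposes\<close>

text \<open>
  \<open>permutation_insert i j\<close> identifies the permutations of the smaller index set with those sending \<open>i\<close>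
  to \<open>j\<close>.
\<close>

lemma trop_det_mat_delete:
  assumes A: "A \<in> carrier_mat n n" and i: "i < n" and j: "j < n"
  shows "trop_det (mat_delete A i j) = adj_entry {0..<n} (\<lambda>x y. A $$ (x, y)) j i"
proof -
  obtain m where n: "n = Suc m" using i by (cases n) auto
  have minor_term: "(\<Prod>x\<in>{0..<n} - {i}. A $$ (x, permutation_insert i j q x))
      = (\<Prod>x = 0..<m. mat_delete A i j $$ (x, q x))" if q: "q permutes {0..<m}" for q
  proof -
    have "(\<Prod>x\<in>{0..<n} - {i}. A $$ (x, permutation_insert i j q x))
        = (\<Prod>x = 0..<m. A $$ (insert_index i x, permutation_insert i j q (insert_index i x)))"
      using insert_index_image[of i m] i insert_index_inj_on[of i "{0..<m}"]
        prod.reindex[of "insert_index i" "{0..<m}" "\<lambda>x. A $$ (x, permutation_insert i j q x)"]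
      by (simp add: n)
    also have "\<dots> = (\<Prod>x = 0..<m. mat_delete A i j $$ (x, q x))"
    proof (rule prod.cong[OF refl])
      fix x assume x: "x \<in> {0..<m}"
      then have "q x < m" using permutes_in_image[OF q, of x] by simp
      moreover have "permutation_insert i j q (insert_index i x) = insert_index j (q x)"
        by (simp add: permutation_insert_expand insert_index_def)
      ultimately show "A $$ (insert_index i x, permutation_insert i j q (insert_index i x))
          = mat_delete A i j $$ (x, q x)"
        using mat_delete_index[of A m i j x "q x"] A i j x n by simp
    qed
    finally show ?thesis .
  qed
  have "adj_entry {0..<n} (\<lambda>x y. A $$ (x, y)) j i
      = (\<Sum>q | q permutes {0..<m}. \<Prod>x\<in>{0..<n} - {i}. A $$ (x, permutation_insert i j q x))"
    unfolding adj_entry_def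
    using permutation_fix[of i m j] permutation_insert_inj_on[of i m j] i j
    by (simp add: n sum.reindex)
  also have "\<dots> = trop_det (mat_delete A i j)"
    using A minor_term unfolding trop_det_def by (auto simp: n intro!: sum.cong)
  finally show ?thesis ..
qed

lemma trop_det_transpose:
  assumes A: "A \<in> carrier_mat n n"
  shows "trop_det A\<^sup>T = trop_det A"
proof -
  have "trop_det A\<^sup>T = (\<Sum>p | p permutes {0..<n}. \<Prod>i = 0..<n. A $$ (p i, i))"
    using A permutes_in_image unfolding trop_det_def
    by (intro sum.cong prod.cong) fastforce+
  also have "\<dots> = (\<Sum>p | p permutes {0..<n}. \<Prod>i = 0..<n. A $$ (i, Hilbert_Choice.inv p i))"
  proof (rule sum.cong[OF refl])
    fix p assume "p \<in> {p. p permutes {0..<n}}"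
    then have p: "p permutes {0..<n}" by simp
    show "(\<Prod>i = 0..<n. A $$ (p i, i)) = (\<Prod>i = 0..<n. A $$ (i, Hilbert_Choice.inv p i))"
      using prod.permute[OF p, of "\<lambda>i. A $$ (i, Hilbert_Choice.inv p i)"] permutes_inverses[OF p] by simp
  qed
  also have "\<dots> = (\<Sum>p | p permutes {0..<n}. \<Prod>i = 0..<n. A $$ (i, p i))"
    by (rule sum.reindex_bij_witness[of _ Hilbert_Choice.inv Hilbert_Choice.inv]) (auto simp: permutes_inv permutes_inv_inv)
  finally show ?thesis
    using A by (simp add: trop_det_def)
qed

lemma trop_nabla_carrier: "A \<in> carrier_mat n n \<Longrightarrow> trop_nabla A \<in> carrier_mat n n"
  by (auto simp: trop_nabla_def trop_adj_def)

lemma trop_nabla_transpose: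
  assumes A: "A \<in> carrier_mat n n"
  shows "(trop_nabla A)\<^sup>T = trop_nabla A\<^sup>T"
proof (rule eq_matI)
  fix i j assume "i < dim_row (trop_nabla A\<^sup>T)" "j < dim_col (trop_nabla A\<^sup>T)"
  then have ij: "i < n" "j < n" using A by (auto simp: trop_nabla_def trop_adj_def)
  have "mat_delete A\<^sup>T j i = (mat_delete A i j)\<^sup>T"
    using A ij by (intro eq_matI) (auto simp: mat_delete_def)
  then show "(trop_nabla A)\<^sup>T $$ (i, j) = trop_nabla A\<^sup>T $$ (i, j)"
    using A ij trop_det_transpose[OF A] trop_det_transpose[OF mat_delete_carrier[OF A]]
    by (simp add: trop_nabla_def trop_adj_def)
qed (use A in \<open>auto simp: trop_nabla_def trop_adj_def\<close>)

lemma quasi_identity_transpose: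
  assumes "quasi_identity G0 n B"
  shows "quasi_identity G0 n B\<^sup>T"
proof -
  obtain Z where Z: "quasi_zero G0 n Z" "B = 1\<^sub>m n + Z"
    using assms by (auto simp: quasi_identity_def)
  then have ZC: "Z \<in> carrier_mat n n" and B: "B \<in> carrier_mat n n"
    by (auto simp: quasi_zero_def)
  have "quasi_zero G0 n Z\<^sup>T"
    using Z(1) by (auto simp: quasi_zero_def)
  moreover have "B\<^sup>T = 1\<^sub>m n + Z\<^sup>T"
    using ZC by (simp add: Z(2) transpose_add[of _ n n])
  moreover have "B\<^sup>T * B\<^sup>T = B\<^sup>T"
    using assms transpose_mult[OF B B] by (simp add: quasi_identity_def)
  ultimately show ?thesis
    using assms trop_det_transpose[OF B] by (auto simp: quasi_identity_def nonsingular_def)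
qed

section \<open>Quasi-inverses\<close>

context supertropical_domain
begin

lemma unit_tangible:
  assumes "a dvd 1"
  shows "a \<in> tangible G0"
proof -
  obtain b where "b * a = 1"
    using assms by (auto simp: dvd_def mult.commute)
  then show ?thesis
    using mult_ghost[of a b] one_tangible by (auto simp: tangible_def)
qed

lemma dominant_permutation:
  assumes "A \<in> carrier_mat n n" "trop_det A dvd 1"
  obtains \<sigma> where "\<sigma> permutes {0..<n}" "trop_det A = (\<Prod>x = 0..<n. A $$ (x, \<sigma> x))"
    "\<And>p. p permutes {0..<n} \<Longrightarrow> p \<noteq> \<sigma> \<Longrightarrow> (\<Prod>x = 0..<n. A $$ (x, p x)) \<prec> trop_det A"
proof -
  have det: "trop_det A = (\<Sum>p | p permutes {0..<n}. \<Prod>x = 0..<n. A $$ (x, p x))"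
    using assms by (simp add: trop_det_def)
  have "\<exists>\<sigma>\<in>{p. p permutes {0..<n}}. trop_det A = (\<Prod>x = 0..<n. A $$ (x, \<sigma> x)) \<and>
      (\<forall>p\<in>{p. p permutes {0..<n}}. p \<noteq> \<sigma> \<longrightarrow>
        (\<Prod>x = 0..<n. A $$ (x, p x)) \<prec> (\<Prod>x = 0..<n. A $$ (x, \<sigma> x)))"
    using tangible_sum_dominant[of "{p. p permutes {0..<n}}" "\<lambda>p. \<Prod>x = 0..<n. A $$ (x, p x)"]
      unit_tangible[OF assms(2)] finite_permutations[OF finite_atLeastLessThan]
    unfolding det by blast
  then obtain \<sigma> where \<sigma>: "\<sigma> permutes {0..<n}" "trop_det A = (\<Prod>x = 0..<n. A $$ (x, \<sigma> x))"
    and less: "\<forall>p\<in>{p. p permutes {0..<n}}. p \<noteq> \<sigma> \<longrightarrow>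
        (\<Prod>x = 0..<n. A $$ (x, p x)) \<prec> (\<Prod>x = 0..<n. A $$ (x, \<sigma> x))"
    by blast
  show ?thesis
  proof (rule that[OF \<sigma>])
    fix p assume "p permutes {0..<n}" "p \<noteq> \<sigma>"
    then have "(\<Prod>x = 0..<n. A $$ (x, p x)) \<prec> (\<Prod>x = 0..<n. A $$ (x, \<sigma> x))"
      using less by blast
    then show "(\<Prod>x = 0..<n. A $$ (x, p x)) \<prec> trop_det A"
      by (simp only: \<sigma>(2))
  qed
qed

text \<open>
  With \<open>t y = A(y, \<sigma> y)\<close> the normalization is \<open>A(x, \<sigma> y) = c x y * t y\<close>. The adjoint entry belonging to
  column \<open>\<sigma> l\<close> carries the factors \<open>t y\<close> for \<open>y \<noteq> l\<close>. Multiplying by \<open>A(i, \<sigma> l)\<close> supplies the missing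
  \<open>t l\<close>, and the product of all \<open>t y\<close> is \<open>|A|\<close>, which cancels against its inverse.
\<close>

lemma quasi_identity_times_nabla:
  assumes A: "A \<in> carrier_mat n n" and unit: "trop_det A dvd 1"
  shows "quasi_identity G0 n (A * trop_nabla A)"
proof -
  let ?U = "{0..<n}"
  let ?d = "trop_det A"
  let ?a = "\<lambda>x y. A $$ (x, y)"
  obtain \<sigma> where \<sigma>: "\<sigma> permutes ?U" and det: "?d = (\<Prod>x\<in>?U. ?a x (\<sigma> x))"
    and dom: "\<And>p. p permutes ?U \<Longrightarrow> p \<noteq> \<sigma> \<Longrightarrow> (\<Prod>x\<in>?U. ?a x (p x)) \<prec> ?d"
    by (rule dominant_permutation[OF assms]) (rule that)
  define t where "t y = ?a y (\<sigma> y)" for y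
  define c where "c x y = ?a x (\<sigma> y) * unit_inverse (t y)" for x y
  have t_inv: "t y * unit_inverse (t y) = 1" if "y \<in> ?U" for y
  proof (rule unit_inverse)
    have "t y dvd ?d"
      unfolding det t_def using that by (intro dvd_prodI) auto
    then show "t y dvd 1" using unit dvd_trans by blast
  qed
  have a_eq: "?a x (\<sigma> y) = c x y * t y" if "y \<in> ?U" for x y
    unfolding c_def using t_inv[OF that] by (metis mult.assoc mult.commute mult_1_right)
  have d_inv: "?d * unit_inverse ?d = 1"
    by (rule unit_inverse[OF unit])
  have prod_t: "(\<Prod>x\<in>?U - {j}. t (p x)) = (\<Prod>y\<in>?U - {p j}. t y)" if "p permutes ?U" for p j
  proof -
    have "p ` (?U - {j}) = ?U - {p j}"
      using permutes_image[OF that] permutes_inj[OF that] by (auto simp: image_set_diff)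
    moreover have "inj_on p (?U - {j})"
      using permutes_inj_on[OF that] .
    ultimately show ?thesis
      using prod.reindex[of p "?U - {j}" t] by simp
  qed
  interpret normalized_matrix G0 \<nu> ?U c
  proof unfold_locales
    show "c x x = 1" if "x \<in> ?U" for x
      using t_inv[OF that] by (simp add: c_def t_def)
    show "(\<Prod>x\<in>?U. c x (p x)) \<prec> 1" if p: "p permutes ?U" "p \<noteq> id" for p
    proof -
      have "(\<Prod>x\<in>?U. ?a x ((\<sigma> \<circ> p) x)) = (\<Prod>x\<in>?U. c x (p x) * t (p x))"
        using p a_eq permutes_in_image[OF p(1)] by (intro prod.cong) auto
      also have "\<dots> = (\<Prod>x\<in>?U. c x (p x)) * ?d"
        using prod.permute[OF p(1), of t] by (simp add: prod.distrib det t_def o_def)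
      finally have eq: "(\<Prod>x\<in>?U. ?a x ((\<sigma> \<circ> p) x)) = (\<Prod>x\<in>?U. c x (p x)) * ?d" .
      obtain x where "p x \<noteq> x"
        using p(2) by fastforce
      then have "(\<sigma> \<circ> p) x \<noteq> \<sigma> x"
        using injD[OF permutes_inj[OF \<sigma>]] by auto
      then have "\<sigma> \<circ> p \<noteq> \<sigma>"
        by metis
      then have "(\<Prod>x\<in>?U. c x (p x)) * ?d \<prec> ?d"
        using dom[OF permutes_compose[OF p(1) \<sigma>]] eq by simp
      \<comment> \<open>Strictness passes to the factor: \<open>1 \<preceq> x\<close> would give \<open>|A| \<preceq> x * |A|\<close>.\<close>
      then show ?thesis
        using ghost_le_mult_right[of 1 "\<Prod>x\<in>?U. c x (p x)" ?d] by (auto simp: ghost_less_def)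
    qed
  qed simp
  have minor: "adj_entry ?U ?a (\<sigma> l) j = adj_entry ?U c l j * (\<Prod>y\<in>?U - {l}. t y)"
    if "j \<in> ?U" "l \<in> ?U" for j l
  proof -
    have "adj_entry ?U ?a (\<sigma> l) j
        = (\<Sum>p | p permutes ?U \<and> p j = l. \<Prod>x\<in>?U - {j}. ?a x (\<sigma> (p x)))"
      unfolding adj_entry_def
      by (rule sum.reindex_bij_witness[of _ "\<lambda>p. \<sigma> \<circ> p" "\<lambda>q. Hilbert_Choice.inv \<sigma> \<circ> q"])
        (auto simp: permutes_compose permutes_inv \<sigma> permutes_inverses[OF \<sigma>] fun_eq_iff)
    also have "\<dots> = (\<Sum>p | p permutes ?U \<and> p j = l. (\<Prod>x\<in>?U - {j}. c x (p x)) * (\<Prod>y\<in>?U - {l}. t y))"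
    proof (rule sum.cong[OF refl])
      fix p assume "p \<in> {p. p permutes ?U \<and> p j = l}"
      then have p: "p permutes ?U" "p j = l" by auto
      have "(\<Prod>x\<in>?U - {j}. ?a x (\<sigma> (p x))) = (\<Prod>x\<in>?U - {j}. c x (p x) * t (p x))"
        using a_eq permutes_in_image[OF p(1)] by (intro prod.cong) auto
      then show "(\<Prod>x\<in>?U - {j}. ?a x (\<sigma> (p x)))
          = (\<Prod>x\<in>?U - {j}. c x (p x)) * (\<Prod>y\<in>?U - {l}. t y)"
        using prod_t[OF p(1), of j] p(2) by (simp add: prod.distrib)
    qed
    finally show ?thesis
      by (simp add: adj_entry_def sum_distrib_right)
  qed
  have entry: "(A * trop_nabla A) $$ (i, j) = times_adj i j" if ij: "i < n" "j < n" for i j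
  proof -
    have "(A * trop_nabla A) $$ (i, j)
        = (\<Sum>k\<in>?U. ?a i k * (unit_inverse ?d * adj_entry ?U ?a k j))"
      using A ij trop_nabla_carrier[OF A] trop_det_mat_delete[OF A ij(2)]
      by (auto simp: scalar_prod_def trop_nabla_def trop_adj_def intro!: sum.cong)
    also have "\<dots> = (\<Sum>l\<in>?U. ?a i (\<sigma> l) * (unit_inverse ?d * adj_entry ?U ?a (\<sigma> l) j))"
      by (subst sum.permute[OF \<sigma>]) (simp add: o_def)
    also have "\<dots> = (\<Sum>l\<in>?U. c i l * adj l j)"
    proof (rule sum.cong[OF refl])
      fix l assume l: "l \<in> ?U"
      have d: "?d = t l * (\<Prod>y\<in>?U - {l}. t y)"
        using l by (simp add: det prod.remove[of ?U l] t_def)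
      have "?a i (\<sigma> l) * (unit_inverse ?d * adj_entry ?U ?a (\<sigma> l) j)
          = c i l * adj l j * ((t l * (\<Prod>y\<in>?U - {l}. t y)) * unit_inverse ?d)"
        using l ij a_eq[OF l] by (simp add: minor ac_simps)
      then show "?a i (\<sigma> l) * (unit_inverse ?d * adj_entry ?U ?a (\<sigma> l) j) = c i l * adj l j"
        unfolding d[symmetric] d_inv by simp
    qed
    finally show ?thesis
      by (simp add: times_adj_def)
  qed
  show ?thesis
    by (rule quasi_identityI[OF mult_carrier_mat[OF A trop_nabla_carrier[OF A]]])
      (simp_all add: entry times_adj_diag times_adj_ghost times_adj_trans
        times_adj_cycle_less_one del: index_mult_mat)
qed

lemma quasi_identity_nabla_times:
  assumes A: "A \<in> carrier_mat n n" and unit: "trop_det A dvd 1"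
  shows "quasi_identity G0 n (trop_nabla A * A)"
proof -
  have "(A\<^sup>T * trop_nabla A\<^sup>T)\<^sup>T = trop_nabla A * A"
    using A trop_nabla_carrier[OF A]
    by (simp add: transpose_mult[of _ n n _ n] flip: trop_nabla_transpose[OF A])
  moreover have "quasi_identity G0 n (A\<^sup>T * trop_nabla A\<^sup>T)"
    using A unit trop_det_transpose[OF A] by (intro quasi_identity_times_nabla) auto
  ultimately show ?thesis
    using quasi_identity_transpose by metis
qed

end

theorem theorem4p13:
  fixes G0 :: "'a::comm_semiring_1 set" and \<nu> :: "'a \<Rightarrow> 'a"
    and n :: nat and A :: "'a mat"
  assumes "supertropical_domain G0 \<nu>"
    and "n \<ge> 1"
    and "A \<in> carrier_mat n n"
    and "trop_det A dvd 1"
  shows "quasi_identity G0 n (A * trop_nabla A) \<and>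
         quasi_identity G0 n (trop_nabla A * A) \<and>
         quasi_inverse G0 n (trop_nabla A) A"
proof -
  interpret supertropical_domain G0 \<nu> by fact
  show ?thesis
    using quasi_identity_times_nabla quasi_identity_nabla_times trop_nabla_carrier assms(3,4)
    by (simp add: quasi_inverse_def)
qed

end
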